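(* Let $\alpha,\beta,c\in\mathbb{C}\setminus\{0\}$ with $\alpha\neq\beta$. Let $\varphi:(x,y)\mapsto(\bar x,\bar y)$ be the birational map of $\mathbb{P}^1\times\mathbb{P}^1$ $$\bar x=\frac{c^2\big((\beta-\alpha)xy+\alpha c^2-\beta x^2\big)}{c^2(\alpha-\beta)x+\beta c^2y-\alpha x^2y},\qquad \bar y=x .$$ Then: (i) for every $n\ge 1$ the degree of the $n$-th iterate $\varphi^n$ in the initial data is $n+1$; (ii) the birational change of variables $$s=\frac{c^2(x-y)}{c^2-xy},\qquad t=x$$ transforms $\varphi$ into $$\bar s=-\frac{\alpha c^2}{\beta s},\qquad \bar t=\frac{\alpha c^2-\beta st}{\alpha t-\beta s},$$ where $\bar s,\bar t$ denote $s,t$ evaluated at $(\bar x,\bar y)=\varphi(x,y)$.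
   Context: The map $\varphi$ is the system form ($x=\bar u$, $y=u$, $a=c^2$) of the second-order equation $\alpha(u\bar u-a)(\bar u\bar{\bar u}-a)-a\beta(u-\bar u)(\bar{\bar u}-\bar u)=0$, which is the reduction $\hat u=a/\bar u$ of the lattice equation $Q1_0$: $\alpha(u-\hat u)(\bar u-\hat{\bar u})-\beta(u-\bar u)(\hat u-\hat{\bar u})=0$. Degree convention: writing $(x_n,y_n)=\varphi^n(x_0,y_0)$, the degree of $\varphi^n$ in the initial data is the maximum of the degrees of $x_n$ and $y_n$ as rational functions of $x_0$ (for generic fixed $y_0$) and as rational functions of $y_0$ (for generic fixed $x_0$), where the degree of a rational function of one variable is the maximum of the degrees of its coprime numerator and denominator. *)

theory Defs
  imports "HOL-Computational_Algebra.Computational_Algebra" "HOL-Computational_Algebra.Field_as_Ring"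
begin

(* C(x) and C(x,y).  In complex poly poly the outer variable is x, the inner one y. *)
type_synonym ratfun1 = "complex poly fract"
type_synonym ratfun2 = "complex poly poly fract"

definition const1 :: "complex \<Rightarrow> ratfun1" where
  "const1 a = to_fract [:a:]"

definition var1 :: ratfun1 where
  "var1 = to_fract [:0, 1:]"

definition const2 :: "complex \<Rightarrow> ratfun2" where
  "const2 a = to_fract [:[:a:]:]"

definition varx :: ratfun2 where
  "varx = to_fract [:0, 1:]"

definition vary :: ratfun2 where
  "vary = to_fract [:[:0, 1:]:]"

definition ratfun_degree :: "ratfun1 \<Rightarrow> nat" where
  "ratfun_degree f = max (degree (fst (quot_of_fract f))) (degree (snd (quot_of_fract f)))"

(* P(u,v) for u, v in a field that contains C via the embedding emb. *)
definition eval2 :: "(complex \<Rightarrow> 'a::field) \<Rightarrow> complex poly poly \<Rightarrow> 'a \<times> 'a \<Rightarrow> 'a" where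
  "eval2 emb P p = poly (map_poly (\<lambda>q. poly (map_poly emb q) (snd p)) P) (fst p)"

(* f can be written as a fraction P/Q with Q(p) nonzero, and f(p) = P(p)/Q(p) = w.
   For a field homomorphism emb, w does not depend on the chosen fraction. *)
definition has_value :: "(complex \<Rightarrow> 'a::field) \<Rightarrow> ratfun2 \<Rightarrow> 'a \<times> 'a \<Rightarrow> 'a \<Rightarrow> bool" where
  "has_value emb f p w \<longleftrightarrow>
     (\<exists>P Q. f = Fract P Q \<and> eval2 emb Q p \<noteq> 0 \<and> w = eval2 emb P p / eval2 emb Q p)"

definition ratfun_value :: "(complex \<Rightarrow> 'a::field) \<Rightarrow> ratfun2 \<Rightarrow> 'a \<times> 'a \<Rightarrow> 'a" where
  "ratfun_value emb f p = (THE w. has_value emb f p w)"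

(* A rational self-map of P^1 x P^1 (no component constantly infinite) is given by
   its pair of components in C(x,y). *)
type_synonym ratmap = "ratfun2 \<times> ratfun2"

definition id_map :: ratmap where
  "id_map = (varx, vary)"

definition comp_defined :: "ratmap \<Rightarrow> ratmap \<Rightarrow> bool" where
  "comp_defined F G \<longleftrightarrow>
     (\<exists>w. has_value const2 (fst F) G w) \<and> (\<exists>w. has_value const2 (snd F) G w)"

(* The composite F o G; it is meaningful if comp_defined F G, in particular
   whenever G is dominant. *)
definition rat_comp :: "ratmap \<Rightarrow> ratmap \<Rightarrow> ratmap" where
  "rat_comp F G = (ratfun_value const2 (fst F) G, ratfun_value const2 (snd F) G)"

definition birational :: "ratmap \<Rightarrow> bool" where
  "birational F \<longleftrightarrow>
     (\<exists>G. comp_defined F G \<and> comp_defined G F \<and>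
          rat_comp F G = id_map \<and> rat_comp G F = id_map)"

definition rat_iterate :: "ratmap \<Rightarrow> nat \<Rightarrow> ratmap" where
  "rat_iterate F n = (rat_comp F ^^ n) id_map"

(* Generic means: for all but finitely many complex values of the fixed variable. *)
definition degree_in_x :: "ratfun2 \<Rightarrow> nat" where
  "degree_in_x f = (THE d. \<forall>\<^sub>F y0 in cofinite.
     \<exists>g. has_value const1 f (var1, const1 y0) g \<and> ratfun_degree g = d)"

definition degree_in_y :: "ratfun2 \<Rightarrow> nat" where
  "degree_in_y f = (THE d. \<forall>\<^sub>F x0 in cofinite.
     \<exists>g. has_value const1 f (const1 x0, var1) g \<and> ratfun_degree g = d)"

definition map_degree :: "ratmap \<Rightarrow> nat" where
  "map_degree F = Max {degree_in_x (fst F), degree_in_x (snd F),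
                       degree_in_y (fst F), degree_in_y (snd F)}"

definition phi :: "complex \<Rightarrow> complex \<Rightarrow> complex \<Rightarrow> ratmap" where
  "phi \<alpha> \<beta> c =
     (const2 (c^2) * (const2 (\<beta> - \<alpha>) * varx * vary + const2 (\<alpha> * c^2) - const2 \<beta> * varx^2) /
        (const2 (c^2 * (\<alpha> - \<beta>)) * varx + const2 (\<beta> * c^2) * vary - const2 \<alpha> * varx^2 * vary),
      varx)"

(* The change of variables (x,y) |-> (s,t). *)
definition st_map :: "complex \<Rightarrow> ratmap" where
  "st_map c = (const2 (c^2) * (varx - vary) / (const2 (c^2) - varx * vary), varx)"

end

(* Put w = (x - c)/(x + c), v = (y - c)/(y + c) and r = w/v.  In these coordinates phi becomes
   (w, r) |-> (w m(r), m(r)) with the Moebius involution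
   m(r) = - ((a + b) + (a - b) r) / ((a - b) + (a + b) r), where a, b stand for alpha, beta.
   Hence w_n = w m(r)^ceil(n/2) r^floor(n/2).  Clearing denominators writes x_n as
   c (D + N)/(D - N) with N and D products of explicit factors without common zeros, so the
   degrees in x and in y can be read off: they are n + 1 and n, and y_n = x_(n-1).
   For a fixed first argument the first component of phi is a Moebius involution of the second
   one, which gives the inverse of phi. *)
theory Submission
  imports Defs
begin

subsection \<open>Substitution into rational functions\<close>

text \<open>One set of rules serves all the maps used below: embeddings of constants, evaluation of
  polynomials, substitution in \<open>eval2\<close>, and \<open>to_fract\<close>.\<close>

locale comm_ring_hom =
  fixes h :: "'a::comm_ring_1 \<Rightarrow> 'b::comm_ring_1"
  assumes hom_add: "h (a + b) = h a + h b"
    and hom_mult: "h (a * b) = h a * h b"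
    and hom_1: "h 1 = 1"
begin

lemma hom_0: "h 0 = 0"
  using hom_add[of 0 0] by simp

lemma hom_minus: "h (- a) = - h a"
  using hom_add[of a "- a"] hom_0 by (simp add: eq_neg_iff_add_eq_0 add.commute)

lemma hom_diff: "h (a - b) = h a - h b"
  using hom_add[of a "- b"] hom_minus by simp

lemma hom_power: "h (a ^ n) = h a ^ n"
  by (induction n) (simp_all add: hom_1 hom_mult)

lemmas hom_simps = hom_0 hom_1 hom_add hom_minus hom_diff hom_mult hom_power

text \<open>Applied twice, to the inner and then to the outer variable, this makes
  \<open>eval2\<close> a ring homomorphism.\<close>

lemma poly_map_poly_hom: "comm_ring_hom (\<lambda>p. poly (map_poly h p) x)"
proof
  fix p q
  show add: "poly (map_poly h (p + q)) x = poly (map_poly h p) x + poly (map_poly h q) x" for p q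
    by (induction p q rule: poly_induct2)
      (simp_all add: map_poly_pCons hom_0 hom_add algebra_simps)
  have smult: "poly (map_poly h (smult a q)) x = h a * poly (map_poly h q) x" for a q
    by (induction q) (simp_all add: map_poly_pCons hom_0 hom_mult algebra_simps)
  show "poly (map_poly h (p * q)) x = poly (map_poly h p) x * poly (map_poly h q) x"
    by (induction p) (simp_all add: map_poly_pCons hom_0 add smult algebra_simps)
  show "poly (map_poly h 1) x = 1"
    using map_poly_1'[of h] by (simp add: hom_1)
qed

end

locale field_embedding = comm_ring_hom emb for emb :: "complex \<Rightarrow> 'a::field"
begin

lemma eval2_hom: "comm_ring_hom (\<lambda>P. eval2 emb P p)"
  unfolding eval2_def
  by (rule comm_ring_hom.poly_map_poly_hom, rule poly_map_poly_hom)

lemmas eval2_simps = comm_ring_hom.hom_simps[OF eval2_hom]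

text \<open>Two representations of \<open>f\<close> satisfy \<open>P * S = R * Q\<close> in the
  polynomial ring, and \<open>eval2\<close> carries this identity to the target field, where both
  denominators are invertible.\<close>

lemma has_value_unique:
  assumes "has_value emb f p v" "has_value emb f p w"
  shows "v = w"
proof -
  obtain P Q where 1: "f = Fract P Q" "eval2 emb Q p \<noteq> 0" "v = eval2 emb P p / eval2 emb Q p"
    using assms(1) unfolding has_value_def by blast
  obtain R S where 2: "f = Fract R S" "eval2 emb S p \<noteq> 0" "w = eval2 emb R p / eval2 emb S p"
    using assms(2) unfolding has_value_def by blast
  have "Q \<noteq> 0" "S \<noteq> 0"
    using 1 2 by (auto simp: eval2_simps)
  with 1 2 have "P * S = R * Q"
    by (simp add: eq_fract)
  then have "eval2 emb P p * eval2 emb S p = eval2 emb R p * eval2 emb Q p"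
    by (metis eval2_simps(6))
  with 1 2 show ?thesis
    by (simp add: frac_eq_eq)
qed

lemma ratfun_value_eq: "has_value emb f p w \<Longrightarrow> ratfun_value emb f p = w"
  unfolding ratfun_value_def using has_value_unique by blast

lemma has_value_to_fract: "has_value emb (to_fract P) p (eval2 emb P p)"
  unfolding has_value_def
  by (rule exI[of _ P], rule exI[of _ 1]) (simp add: to_fract_def eval2_simps)

lemma has_value_const: "has_value emb (const2 a) p (emb a)"
  using has_value_to_fract[of "[:[:a:]:]" p]
  by (simp add: const2_def eval2_def map_poly_pCons hom_0)

lemma has_value_varx: "has_value emb varx (x, y) x"
  using has_value_to_fract[of "[:0, 1:]" "(x, y)"]
  by (simp add: varx_def eval2_def map_poly_pCons hom_0 hom_1 map_poly_1')

lemma has_value_vary: "has_value emb vary (x, y) y"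
  using has_value_to_fract[of "[:[:0, 1:]:]" "(x, y)"]
  by (simp add: vary_def eval2_def map_poly_pCons hom_0 hom_1 map_poly_1')

lemma has_value_minus: "has_value emb f p v \<Longrightarrow> has_value emb (- f) p (- v)"
  unfolding has_value_def
  by (metis minus_fract eval2_simps(4) minus_divide_left)

lemma has_value_add:
  assumes "has_value emb f p v" "has_value emb g p w"
  shows "has_value emb (f + g) p (v + w)"
proof -
  obtain P Q where 1: "f = Fract P Q" "eval2 emb Q p \<noteq> 0" "v = eval2 emb P p / eval2 emb Q p"
    using assms(1) unfolding has_value_def by blast
  obtain R S where 2: "g = Fract R S" "eval2 emb S p \<noteq> 0" "w = eval2 emb R p / eval2 emb S p"
    using assms(2) unfolding has_value_def by blast
  have "Q \<noteq> 0" "S \<noteq> 0"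
    using 1 2 by (auto simp: eval2_simps)
  then show ?thesis
    unfolding has_value_def using 1 2
    by (intro exI[of _ "P * S + R * Q"] exI[of _ "Q * S"])
      (simp add: eval2_simps add_frac_eq)
qed

lemma has_value_diff:
  "has_value emb f p v \<Longrightarrow> has_value emb g p w \<Longrightarrow> has_value emb (f - g) p (v - w)"
  using has_value_add[of f p v "- g" "- w"] has_value_minus[of g p w] by simp

lemma has_value_mult:
  assumes "has_value emb f p v" "has_value emb g p w"
  shows "has_value emb (f * g) p (v * w)"
proof -
  obtain P Q where 1: "f = Fract P Q" "eval2 emb Q p \<noteq> 0" "v = eval2 emb P p / eval2 emb Q p"
    using assms(1) unfolding has_value_def by blast
  obtain R S where 2: "g = Fract R S" "eval2 emb S p \<noteq> 0" "w = eval2 emb R p / eval2 emb S p"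
    using assms(2) unfolding has_value_def by blast
  show ?thesis
    unfolding has_value_def using 1 2
    by (intro exI[of _ "P * R"] exI[of _ "Q * S"]) (simp add: eval2_simps)
qed

lemma has_value_power: "has_value emb f p v \<Longrightarrow> has_value emb (f ^ n) p (v ^ n)"
  by (induction n)
    (use has_value_const[of 1 p] in \<open>simp_all add: has_value_mult const2_def hom_1 flip: one_pCons\<close>)

text \<open>Swapping numerator and denominator represents the inverse of \<open>g\<close>; the new
  denominator is nonzero at \<open>p\<close> because \<open>w\<close> is.\<close>

lemma has_value_divide:
  assumes "has_value emb f p v" "has_value emb g p w" "w \<noteq> 0"
  shows "has_value emb (f / g) p (v / w)"
proof -
  obtain R S where "g = Fract R S" "eval2 emb S p \<noteq> 0" "w = eval2 emb R p / eval2 emb S p"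
    using assms(2) unfolding has_value_def by blast
  with \<open>w \<noteq> 0\<close> have "has_value emb (inverse g) p (inverse w)"
    unfolding has_value_def
    by (intro exI[of _ S] exI[of _ R]) simp
  from has_value_mult[OF assms(1) this] show ?thesis
    by (simp add: divide_inverse)
qed

lemmas has_value_intros = has_value_const has_value_varx has_value_vary has_value_minus
  has_value_add has_value_diff has_value_mult has_value_power has_value_divide

text \<open>A single complex point with nonzero value certifies that an explicit rational function
  is nonzero. All nonvanishing checks in C(x,y) below are done this way.\<close>

lemma nonzero_if_has_value: "has_value emb f p w \<Longrightarrow> w \<noteq> 0 \<Longrightarrow> f \<noteq> 0"
  using has_value_const[of 0 p] has_value_unique
  by (fastforce simp: const2_def hom_0)

end

lemma field_embedding_const1: "field_embedding const1"
  by unfold_locales (simp_all add: const1_def mult.commute one_pCons flip: to_fract_1 to_fract_add to_fract_mult)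

lemma field_embedding_const2: "field_embedding const2"
  by unfold_locales (simp_all add: const2_def mult.commute one_pCons flip: to_fract_1 to_fract_add to_fract_mult)

lemma field_embedding_id: "field_embedding (\<lambda>a. a)"
  by unfold_locales simp_all

text \<open>The three targets: C(z) for fixing one variable, C(x,y) for composing maps, and C for
  evaluating at points.\<close>

interpretation c1: field_embedding const1 by (rule field_embedding_const1)
interpretation c2: field_embedding const2 by (rule field_embedding_const2)
interpretation pt: field_embedding "\<lambda>a. a" by (rule field_embedding_id)

text \<open>Cross-multiplying with the normalised fraction \<open>(a, b)\<close> gives
  \<open>a * q = p * b\<close>; coprimality on both sides makes \<open>a\<close>, \<open>p\<close>
  and \<open>b\<close>, \<open>q\<close> associated, hence of equal degree.\<close>

lemma ratfun_degree_coprime: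
  assumes "coprime p q" "q \<noteq> 0"
  shows "ratfun_degree (to_fract p / to_fract q) = max (degree p) (degree q)"
proof -
  define f where "f = to_fract p / to_fract q"
  obtain a b where ab: "quot_of_fract f = (a, b)" by fastforce
  have b: "b \<noteq> 0" "coprime a b"
    using snd_quot_of_fract_nonzero[of f] coprime_quot_of_fract[of f] ab by simp_all
  have "Fract a b = Fract p q"
    using Fract_quot_of_fract[of f] unfolding ab by (simp add: f_def Fract_conv_to_fract)
  then have eq: "a * q = p * b"
    using b assms by (simp add: eq_fract)
  have "a dvd p" "p dvd a" "b dvd q" "q dvd b"
    using eq b assms 
    by (metis coprime_dvd_mult_left_iff dvd_triv_left coprime_commute coprime_dvd_mult_right_iff dvd_triv_right)+
  then have "degree a = degree p" "degree b = degree q"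
    by (metis dvd_imp_degree_le dvd_0_left_iff antisym)+
  then show ?thesis
    using ab by (simp add: ratfun_degree_def f_def)
qed

subsection \<open>The map in Cayley coordinates\<close>

text \<open>Inverse of the coordinate w = (x - c)/(x + c).\<close>

definition cayley :: "'a::field \<Rightarrow> 'a \<Rightarrow> 'a" where
  "cayley c w = c * (1 + w) / (1 - w)"

definition phi_x :: "'a::field \<Rightarrow> 'a \<Rightarrow> 'a \<Rightarrow> 'a \<Rightarrow> 'a \<Rightarrow> 'a" where
  "phi_x a b c x y = c^2 * ((b - a) * x * y + a * c^2 - b * x^2) /
     (c^2 * (a - b) * x + b * c^2 * y - a * x^2 * y)"

definition phi_den :: "'a::field \<Rightarrow> 'a \<Rightarrow> 'a \<Rightarrow> 'a \<Rightarrow> 'a \<Rightarrow> 'a" where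
  "phi_den a b c x y = c^2 * (a - b) * x + b * c^2 * y - a * x^2 * y"

definition ratio_step :: "'a::field \<Rightarrow> 'a \<Rightarrow> 'a \<Rightarrow> 'a" where
  "ratio_step a b r = - ((a + b) + (a - b) * r) / ((a - b) + (a + b) * r)"

text \<open>This is the conjugation of the map to (w, r) -> (w m(r), m(r)). The three conditions
  that a coordinate differs from 1 keep x, y and the image finite.\<close>

lemma cayley_phi:
  fixes a b c w r :: "'a::field"
  assumes nz: "(2::'a) \<noteq> 0" "c \<noteq> 0" "w \<noteq> 0" "r \<noteq> 0"
    and "w \<noteq> 1" "w / r \<noteq> 1" and r: "(a - b) + (a + b) * r \<noteq> 0"
    and w': "w * ratio_step a b r \<noteq> 1"
  shows "phi_den a b c (cayley c w) (cayley c (w / r)) \<noteq> 0"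
    and "phi_x a b c (cayley c w) (cayley c (w / r)) = cayley c (w * ratio_step a b r)"
proof -
  define D where "D = (a - b) + (a + b) * r"
  define N where "N = (a + b) + (a - b) * r"
  define x y where "x = cayley c w" and "y = cayley c (w / r)"
  have w1: "1 - w \<noteq> 0" "r - w \<noteq> 0"
    using assms by (auto simp: field_simps)
  have x: "x * (1 - w) = c * (1 + w)" and y: "y * (r - w) = c * (r + w)"
    using w1 nz by (simp_all add: x_def y_def cayley_def field_simps)
  have D: "D \<noteq> 0" "D + w * N \<noteq> 0"
    using r w' by (auto simp: D_def N_def ratio_step_def field_simps add_eq_0_iff)
  \<comment> \<open>The denominator is quadratic in x and linear in y, so this multiplier clears all
    fractions. The numerator below yields the same factor with \<open>D - w * N\<close>, and the
    quotient is the Cayley image of \<open>- w * N / D\<close>.\<close>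
  have den: "phi_den a b c x y * ((1 - w)^2 * (r - w)) = - 2 * c^3 * w * (D + w * N)"
  proof -
    have "phi_den a b c x y * ((1 - w)^2 * (r - w)) =
      c^2 * (a - b) * (x * (1 - w)) * (1 - w) * (r - w) + b * c^2 * (y * (r - w)) * (1 - w)^2
        - a * (x * (1 - w))^2 * (y * (r - w))"
      unfolding phi_den_def by algebra
    also have "\<dots> = - 2 * c^3 * w * (D + w * N)"
      unfolding x y D_def N_def by algebra
    finally show ?thesis .
  qed
  have num: "((b - a) * x * y + a * c^2 - b * x^2) * ((1 - w)^2 * (r - w))
    = - 2 * c^2 * w * (D - w * N)"
  proof -
    have "((b - a) * x * y + a * c^2 - b * x^2) * ((1 - w)^2 * (r - w)) =
      (b - a) * (x * (1 - w)) * (y * (r - w)) * (1 - w) + a * c^2 * (1 - w)^2 * (r - w)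
        - b * (x * (1 - w))^2 * (r - w)"
      by algebra
    also have "\<dots> = - 2 * c^2 * w * (D - w * N)"
      unfolding x y D_def N_def by algebra
    finally show ?thesis .
  qed
  have rhs: "cayley c (w * ratio_step a b r) = c * (D - w * N) / (D + w * N)"
  proof -
    have "w * ratio_step a b r = - (w * N) / D"
      unfolding ratio_step_def D_def[symmetric] N_def[symmetric] by simp
    moreover have "1 + - (w * N) / D = (D - w * N) / D" "1 - - (w * N) / D = (D + w * N) / D"
      using D by (simp_all add: field_simps)
    ultimately show ?thesis
      unfolding cayley_def using D by simp
  qed
  show nd: "phi_den a b c x y \<noteq> 0"
    using den D nz by auto
  have "c^2 * ((b - a) * x * y + a * c^2 - b * x^2) * (D + w * N) * ((1 - w)^2 * (r - w))
      = c^2 * (D + w * N) * (((b - a) * x * y + a * c^2 - b * x^2) * ((1 - w)^2 * (r - w)))"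
    by (simp only: mult_ac)
  also have "\<dots> = c * (D - w * N) * (phi_den a b c x y * ((1 - w)^2 * (r - w)))"
    unfolding num den by algebra
  finally have "c^2 * ((b - a) * x * y + a * c^2 - b * x^2) * (D + w * N) * ((1 - w)^2 * (r - w))
      = c * (D - w * N) * phi_den a b c x y * ((1 - w)^2 * (r - w))"
    by (simp only: mult_ac)
  then have "c^2 * ((b - a) * x * y + a * c^2 - b * x^2) * (D + w * N) = c * (D - w * N) * phi_den a b c x y"
    using w1 by simp
  then show "phi_x a b c x y = cayley c (w * ratio_step a b r)"
    unfolding phi_x_def rhs phi_den_def[symmetric] using nd D by (simp add: frac_eq_eq)
qed

text \<open>If m(r) were the pole of m, clearing denominators would force 4 a b = 0.\<close>

lemma ratio_step_nonzero:
  fixes a b r :: "'a::field"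
  assumes "(2::'a) \<noteq> 0" "a \<noteq> 0" "b \<noteq> 0" "(a - b) + (a + b) * r \<noteq> 0"
  shows "(a - b) + (a + b) * ratio_step a b r \<noteq> 0"
proof
  assume "(a - b) + (a + b) * ratio_step a b r = 0"
  then have "(a - b) * ((a - b) + (a + b) * r) = (a + b) * ((a + b) + (a - b) * r)"
    using assms(4) by (simp add: ratio_step_def divide_simps) (simp add: algebra_simps)
  then have "2 * 2 * a * b = 0" by algebra
  with assms show False by (metis mult_eq_0_iff)
qed

text \<open>The matrix of m has trace zero and determinant 4 a b, so its square is a nonzero
  scalar.\<close>

lemma ratio_step_involution:
  fixes a b r :: "'a::field"
  assumes "(2::'a) \<noteq> 0" "a \<noteq> 0" "b \<noteq> 0" "(a - b) + (a + b) * r \<noteq> 0"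
  shows "ratio_step a b (ratio_step a b r) = r"
proof -
  define D where "D = (a - b) + (a + b) * r"
  define N where "N = (a + b) + (a - b) * r"
  have D: "D \<noteq> 0" using assms by (simp add: D_def)
  have 1: "ratio_step a b r = - N / D"
    by (simp add: ratio_step_def N_def D_def)
  have 2: "(a - b) * D - (a + b) * N = - (2 * 2 * a * b)" "(a + b) * D - (a - b) * N = 2 * 2 * a * b * r"
    unfolding D_def N_def by algebra+
  have nz: "(a - b) * D - (a + b) * N \<noteq> 0" 
    using assms unfolding 2 by (metis mult_eq_0_iff neg_equal_0_iff_equal)
  have "ratio_step a b (- N / D) = - ((a + b) * D - (a - b) * N) / ((a - b) * D - (a + b) * N)"
  proof -
    have "(a + b) + (a - b) * (- N / D) = ((a + b) * D - (a - b) * N) / D"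
      "(a - b) + (a + b) * (- N / D) = ((a - b) * D - (a + b) * N) / D"
      using D by (simp_all add: field_simps)
    then show ?thesis
      unfolding ratio_step_def using D by simp
  qed
  also have "\<dots> = r"
    using nz unfolding 2 by (simp add: field_simps)
  finally show ?thesis unfolding 1 .
qed

text \<open>As a Moebius map in y, with x fixed, \<open>phi_x\<close> has trace zero and determinant
  - a b c^2 (c^2 - x^2)^2; the condition on \<open>x^2\<close> keeps it invertible.\<close>

lemma phi_x_involution:
  fixes a b c x y :: "'a::field"
  assumes "a \<noteq> 0" "b \<noteq> 0" "c \<noteq> 0" "x^2 \<noteq> c^2" "phi_den a b c x y \<noteq> 0"
  shows "phi_den a b c x (phi_x a b c x y) \<noteq> 0"
    and "phi_x a b c x (phi_x a b c x y) = y"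
proof -
  define z where "z = phi_x a b c x y"
  define d where "d = phi_den a b c x y"
  have z: "z * d = c^2 * ((b - a) * x * y + a * c^2 - b * x^2)"
    using assms(5) by (simp add: z_def d_def phi_x_def phi_den_def)
  have k: "a * b * c^2 * (c^2 - x^2)^2 \<noteq> 0"
    using assms by simp
  have "phi_den a b c x z * d = c^2 * (a - b) * x * d + (b * c^2 - a * x^2) * (z * d)"
    unfolding phi_den_def by algebra
  also have "\<dots> = a * b * c^2 * (c^2 - x^2)^2"
    unfolding z unfolding d_def phi_den_def by algebra
  finally have den: "phi_den a b c x z * d = a * b * c^2 * (c^2 - x^2)^2" .
  have "c^2 * ((b - a) * x * z + a * c^2 - b * x^2) * d
      = c^2 * (b - a) * x * (z * d) + c^2 * (a * c^2 - b * x^2) * d"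
    by algebra
  also have "\<dots> = y * (a * b * c^2 * (c^2 - x^2)^2)"
    unfolding z unfolding d_def phi_den_def by algebra
  also have "\<dots> = y * phi_den a b c x z * d"
    using den by algebra
  finally have num: "c^2 * ((b - a) * x * z + a * c^2 - b * x^2) = y * phi_den a b c x z"
    using assms(5) by (simp add: d_def)
  show "phi_den a b c x z \<noteq> 0"
    using den k by auto
  then show "phi_x a b c x z = y"
    using num unfolding phi_x_def phi_den_def[symmetric] by simp
qed

subsection \<open>Closed form of the orbit\<close>

text \<open>The quotient of the next two polynomials is the coordinate $w$ of the $n$-th iterate.\<close>

definition orbit_num :: "'a::comm_ring_1 \<Rightarrow> 'a \<Rightarrow> 'a \<Rightarrow> nat \<Rightarrow> 'a \<Rightarrow> 'a \<Rightarrow> 'a" where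
  "orbit_num a b c n x y = (x - c)^(1 + n div 2) * (y + c)^(n div 2) *
     (- ((a + b) * ((x + c) * (y - c)) + (a - b) * ((x - c) * (y + c))))^((n + 1) div 2)"

definition orbit_den :: "'a::comm_ring_1 \<Rightarrow> 'a \<Rightarrow> 'a \<Rightarrow> nat \<Rightarrow> 'a \<Rightarrow> 'a \<Rightarrow> 'a" where
  "orbit_den a b c n x y = (x + c)^(1 + n div 2) * (y - c)^(n div 2) *
     ((a - b) * ((x + c) * (y - c)) + (a + b) * ((x - c) * (y + c)))^((n + 1) div 2)"

context comm_ring_hom
begin

text \<open>The same formula is used in C, in C[z], in C(z) and in C(x,y); homomorphisms pass
  between these rings.\<close>

lemma hom_orbit_num: "h (orbit_num a b c n x y) = orbit_num (h a) (h b) (h c) n (h x) (h y)"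
  by (simp add: orbit_num_def hom_simps del: add_Suc)

lemma hom_orbit_den: "h (orbit_den a b c n x y) = orbit_den (h a) (h b) (h c) n (h x) (h y)"
  by (simp add: orbit_den_def hom_simps del: add_Suc)

end

context field_embedding
begin

lemma has_value_orbit_num:
  "has_value emb (orbit_num (const2 a) (const2 b) (const2 c) n varx vary) (x, y)
     (orbit_num (emb a) (emb b) (emb c) n x y)"
  unfolding orbit_num_def by (intro has_value_intros)

lemma has_value_orbit_den:
  "has_value emb (orbit_den (const2 a) (const2 b) (const2 c) n varx vary) (x, y)
     (orbit_den (emb a) (emb b) (emb c) n x y)"
  unfolding orbit_den_def by (intro has_value_intros)

lemma has_value_phi_x:
  "phi_den (emb a) (emb b) (emb c) x y \<noteq> 0 \<Longrightarrow>
     has_value emb (phi_x (const2 a) (const2 b) (const2 c) varx vary) (x, y)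
     (phi_x (emb a) (emb b) (emb c) x y)"
  unfolding phi_x_def phi_den_def by (intro has_value_intros)

end

text \<open>The factors of both products are governed by u, v and two linear forms in u, v of
  determinant 4 a b. A common zero forces u = v = 0, that is x = y = c or x = y = - c. One
  coordinate away from c and - c therefore suffices.\<close>

lemma orbit_no_common_zero:
  fixes a b c x y :: complex
  assumes "a \<noteq> 0" "b \<noteq> 0" "c \<noteq> 0" "a \<noteq> b" "(x \<noteq> c \<and> x \<noteq> - c) \<or> (y \<noteq> c \<and> y \<noteq> - c)"
  shows "\<not> (orbit_num a b c n x y = 0 \<and> orbit_den a b c n x y = 0)"
proof
  define u v where "u = (x + c) * (y - c)" and "v = (x - c) * (y + c)"
  assume "orbit_num a b c n x y = 0 \<and> orbit_den a b c n x y = 0"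
  moreover have "u = 0 \<longleftrightarrow> x + c = 0 \<or> y - c = 0" "v = 0 \<longleftrightarrow> x - c = 0 \<or> y + c = 0"
    by (simp_all add: u_def v_def)
  ultimately have N: "v = 0 \<or> (a + b) * u + (a - b) * v = 0" and D: "u = 0 \<or> (a - b) * u + (a + b) * v = 0"
    unfolding orbit_num_def orbit_den_def u_def[symmetric] v_def[symmetric]
      mult_eq_0_iff power_eq_0_iff neg_equal_0_iff_equal
    by blast+
  have nz: "u \<noteq> 0 \<or> v \<noteq> 0"
    using assms by (auto simp: u_def v_def add_eq_0_iff)
  show False
  proof (cases "u = 0 \<or> v = 0")
    \<comment> \<open>When one of u, v is zero, a linear form reduces to (a - b) times the other, so
      \<open>a \<noteq> b\<close> makes both zero.\<close>
    case True
    with N D nz assms show False by auto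
  next
    case False
    with N D have "(a + b) * u + (a - b) * v = 0" "(a - b) * u + (a + b) * v = 0"
      by auto
    then have "2 * 2 * a * b * u = 0"
      by algebra
    with False assms show False by simp
  qed
qed

text \<open>As m is an involution, the ratio alternates between r and m(r). A step from even n
  contributes m(r), the third factor; a step from odd n contributes m(m(r)) = r, the first
  two.\<close>

lemma orbit_ratio_Suc:
  fixes a b c x y :: "'a::field"
  assumes "(2::'a) \<noteq> 0" "a \<noteq> 0" "b \<noteq> 0" "x + c \<noteq> 0" "y + c \<noteq> 0" "y - c \<noteq> 0"
    and D: "(a - b) * ((x + c) * (y - c)) + (a + b) * ((x - c) * (y + c)) \<noteq> 0"
  defines "r \<equiv> (x - c) * (y + c) / ((x + c) * (y - c))"
  shows "(a - b) + (a + b) * r \<noteq> 0"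
    and "orbit_num a b c (Suc n) x y / orbit_den a b c (Suc n) x y =
      orbit_num a b c n x y / orbit_den a b c n x y *
        ratio_step a b (if even n then r else ratio_step a b r)"
proof -
  have u: "(x + c) * (y - c) \<noteq> 0" using assms by simp
  have 1: "(a - b) + (a + b) * r = ((a - b) * ((x + c) * (y - c)) + (a + b) * ((x - c) * (y + c))) / ((x + c) * (y - c))"
    "(a + b) + (a - b) * r = ((a + b) * ((x + c) * (y - c)) + (a - b) * ((x - c) * (y + c))) / ((x + c) * (y - c))"
    unfolding r_def using u by (simp_all add: add_divide_distrib)
  show nz: "(a - b) + (a + b) * r \<noteq> 0"
    unfolding 1 using u D by simp
  have s: "ratio_step a b r = - ((a + b) * ((x + c) * (y - c)) + (a - b) * ((x - c) * (y + c))) /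
     ((a - b) * ((x + c) * (y - c)) + (a + b) * ((x - c) * (y + c)))"
    unfolding ratio_step_def 1 using u by simp
  show "orbit_num a b c (Suc n) x y / orbit_den a b c (Suc n) x y =
      orbit_num a b c n x y / orbit_den a b c n x y *
        ratio_step a b (if even n then r else ratio_step a b r)"
  proof (cases "even n")
    case True
    then have "Suc n div 2 = n div 2" "(Suc n + 1) div 2 = Suc ((n + 1) div 2)"
      by presburger+
    then show ?thesis
      unfolding orbit_num_def orbit_den_def power_Suc2 if_P[OF True] s
      by (simp only: power_Suc2 mult.assoc times_divide_times_eq)
  next
    case False
    then have "Suc n div 2 = Suc (n div 2)" "(Suc n + 1) div 2 = (n + 1) div 2"
      by presburger+
    then show ?thesis
      unfolding orbit_num_def orbit_den_def if_not_P[OF False]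
        ratio_step_involution[OF assms(1-3) nz] unfolding r_def
      by (simp only: power_Suc2 add_Suc_right mult_ac times_divide_times_eq)
  qed
qed

subsection \<open>Degrees\<close>

lemma coprime_if_no_common_root:
  fixes p q :: "complex poly"
  assumes "\<And>z. \<not> (poly p z = 0 \<and> poly q z = 0)"
  shows "coprime p q"
proof (rule coprimeI)
  fix d assume d: "d dvd p" "d dvd q"
  have nr: "poly d z \<noteq> 0" for z
    using assms[of z] d by (auto elim!: dvdE)
  then have "d \<noteq> 0" by auto
  have "degree d = 0"
    using alg_closed_imp_poly_has_root nr by blast
  with \<open>d \<noteq> 0\<close> show "is_unit d"
    by (simp add: is_unit_iff_degree)
qed

text \<open>Passing from (p, q) to (c (q + p), q - p) is an invertible linear change, which
  preserves both the absence of common zeros and the larger degree.\<close>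

lemma ratfun_degree_cayley:
  fixes p q :: "complex poly"
  assumes "c \<noteq> 0" "\<And>z. \<not> (poly p z = 0 \<and> poly q z = 0)" "p \<noteq> q"
  shows "ratfun_degree (const1 c * (to_fract q + to_fract p) / (to_fract q - to_fract p)) = max (degree p) (degree q)"
proof -
  define s t where "s = smult c (q + p)" and "t = q - p"
  have "coprime s t"
  proof (rule coprime_if_no_common_root)
    show "\<not> (poly s z = 0 \<and> poly t z = 0)" for z
      using assms(1) assms(2)[of z] by (auto simp: s_def t_def)
  qed
  moreover have "const1 c * (to_fract q + to_fract p) / (to_fract q - to_fract p) = to_fract s / to_fract t"
    unfolding s_def t_def const1_def to_fract_add[symmetric] to_fract_diff[symmetric] to_fract_mult[symmetric]
    by simp
  moreover have "max (degree s) (degree t) = max (degree p) (degree q)"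
  proof (rule antisym)
    show "max (degree s) (degree t) \<le> max (degree p) (degree q)"
      using degree_add_le_max[of q p] degree_diff_le_max[of q p]
      by (auto simp: s_def t_def assms(1))
    \<comment> \<open>Inverting the linear change gives the reverse inequality.\<close>
    have "smult (1 / c) s - t = smult 2 p" "smult (1 / c) s + t = smult 2 q"
      using assms(1) by (simp_all add: s_def t_def poly_eq_iff numeral_poly)
    then show "max (degree p) (degree q) \<le> max (degree s) (degree t)"
      using degree_add_le_max[of "smult (1 / c) s" t] degree_diff_le_max[of "smult (1 / c) s" t]
      by (auto simp: assms(1))
  qed
  ultimately show ?thesis
    using ratfun_degree_coprime[of s t] assms(3) by (simp add: t_def)
qed

section \<open>Generic degrees of the orbit in each variable\<close>

lemma to_fract_hom: "comm_ring_hom to_fract"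
  by unfold_locales simp_all

lemma poly_hom: "comm_ring_hom (\<lambda>p. poly p z)"
  by unfold_locales simp_all

text \<open>The degree is well defined: two cofinite sets of values \<open>y0\<close> in the
  infinite field C meet, and at a common point the specialised function is unique.\<close>

lemma degree_in_x_eqI:
  assumes "finite B" and "\<And>y0. y0 \<notin> B \<Longrightarrow> \<exists>g. has_value const1 f (var1, const1 y0) g \<and> ratfun_degree g = d"
  shows "degree_in_x f = d"
  unfolding degree_in_x_def
proof (rule the_equality)
  show ev: "\<forall>\<^sub>F y0 in cofinite. \<exists>g. has_value const1 f (var1, const1 y0) g \<and> ratfun_degree g = d"
    unfolding eventually_cofinite using assms by (auto intro: finite_subset[of _ B])
  fix e assume "\<forall>\<^sub>F y0 in cofinite. \<exists>g. has_value const1 f (var1, const1 y0) g \<and> ratfun_degree g = e"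
  with ev have "\<forall>\<^sub>F y0::complex in cofinite. e = d"
    by eventually_elim (use c1.has_value_unique in blast)
  then show "e = d"
    by (simp add: eventually_const infinite_UNIV_char_0)
qed

lemma degree_in_y_eqI:
  assumes "finite B" and "\<And>x0. x0 \<notin> B \<Longrightarrow> \<exists>g. has_value const1 f (const1 x0, var1) g \<and> ratfun_degree g = d"
  shows "degree_in_y f = d"
  unfolding degree_in_y_def
proof (rule the_equality)
  show ev: "\<forall>\<^sub>F x0 in cofinite. \<exists>g. has_value const1 f (const1 x0, var1) g \<and> ratfun_degree g = d"
    unfolding eventually_cofinite using assms by (auto intro: finite_subset[of _ B])
  fix e assume "\<forall>\<^sub>F x0 in cofinite. \<exists>g. has_value const1 f (const1 x0, var1) g \<and> ratfun_degree g = e"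
  with ev have "\<forall>\<^sub>F x0::complex in cofinite. e = d"
    by eventually_elim (use c1.has_value_unique in blast)
  then show "e = d"
    by (simp add: eventually_const infinite_UNIV_char_0)
qed

text \<open>The Cayley image of N/D with the inner fraction cleared, so that a substitution only has
  to keep \<open>D - N\<close> nonzero.\<close>

definition orbit_x :: "complex \<Rightarrow> complex \<Rightarrow> complex \<Rightarrow> nat \<Rightarrow> ratfun2" where
  "orbit_x a b c n = (let N = orbit_num (const2 a) (const2 b) (const2 c) n varx vary;
      D = orbit_den (const2 a) (const2 b) (const2 c) n varx vary
    in const2 c * (D + N) / (D - N))"

text \<open>Used with one of \<open>u\<close>, \<open>v\<close> the variable and the other a
  constant.\<close>

lemma orbit_x_specialize:
  fixes a b c :: complex and p q u v :: "complex poly"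
  assumes p: "p = orbit_num [:a:] [:b:] [:c:] n u v" and q: "q = orbit_den [:a:] [:b:] [:c:] n u v"
    and "c \<noteq> 0" "p \<noteq> q" "\<And>z. \<not> (poly p z = 0 \<and> poly q z = 0)"
  shows "\<exists>g. has_value const1 (orbit_x a b c n) (to_fract u, to_fract v) g \<and>
    ratfun_degree g = max (degree p) (degree q)"
proof -
  have "orbit_num (const1 a) (const1 b) (const1 c) n (to_fract u) (to_fract v) = to_fract p"
    "orbit_den (const1 a) (const1 b) (const1 c) n (to_fract u) (to_fract v) = to_fract q"
    by (simp_all add: p q const1_def comm_ring_hom.hom_orbit_num[OF to_fract_hom]
        comm_ring_hom.hom_orbit_den[OF to_fract_hom])
  moreover have "to_fract q - to_fract p \<noteq> 0"
    using assms(4) by simp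
  ultimately have "has_value const1 (orbit_x a b c n) (to_fract u, to_fract v)
      (const1 c * (to_fract q + to_fract p) / (to_fract q - to_fract p))"
    unfolding orbit_x_def Let_def
    by (metis c1.has_value_intros(1,5,6,7,9) c1.has_value_orbit_num c1.has_value_orbit_den)
  then show ?thesis
    using ratfun_degree_cayley[OF assms(3,5,4)] by blast
qed

lemma degree_prod3_eq:
  fixes u v w :: "complex poly"
  assumes "u \<noteq> 0" "v \<noteq> 0" "w \<noteq> 0"
  shows "degree (u^i * v^j * w^k) = i * degree u + j * degree v + k * degree w"
  using assms by (simp add: degree_mult_eq degree_power_eq)

lemma degree_prod3_le:
  fixes u v w :: "complex poly"
  shows "degree (u^i * v^j * w^k) \<le> i * degree u + j * degree v + k * degree w"
  by (cases "u^i * v^j * w^k = 0") (simp, auto simp: degree_mult_eq degree_power_eq power_0_left)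

lemma neq_if_no_common_root:
  fixes p q :: "complex poly"
  assumes "\<And>z. \<not> (poly p z = 0 \<and> poly q z = 0)" "degree p > 0 \<or> degree q > 0"
  shows "p \<noteq> q"
  using assms alg_closed_imp_poly_has_root by blast

context
  fixes a b c :: complex
  assumes nz: "a \<noteq> 0" "b \<noteq> 0" "c \<noteq> 0" "a \<noteq> b"
begin

lemma degree_in_x_orbit_x: "degree_in_x (orbit_x a b c n) = n + 1"
proof (rule degree_in_x_eqI)
  \<comment> \<open>Away from c and - c there are no common zeros and the constant factors survive.
    At c b / a the leading coefficient of the last factor of \<open>p\<close>, namely - 2 (a y0 - b
    c), vanishes. Elsewhere \<open>p\<close> attains the degree n + 1, and for \<open>q\<close> an
    upper bound is enough.\<close>
  show "finite {c, - c, c * b / a}" by simp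
  fix y0 assume y0: "y0 \<notin> {c, - c, c * b / a}"
  define p where "p = orbit_num [:a:] [:b:] [:c:] n [:0, 1:] [:y0:]"
  define q where "q = orbit_den [:a:] [:b:] [:c:] n [:0, 1:] [:y0:]"
  have poly: "poly p z = orbit_num a b c n z y0" "poly q z = orbit_den a b c n z y0" for z
    by (simp_all add: p_def q_def comm_ring_hom.hom_orbit_num[OF poly_hom]
        comm_ring_hom.hom_orbit_den[OF poly_hom])
  have no_root: "\<not> (poly p z = 0 \<and> poly q z = 0)" for z
    unfolding poly using orbit_no_common_zero y0 nz by auto
  have lead: "(a + b) * (y0 - c) + (a - b) * (y0 + c) \<noteq> 0"
  proof
    assume "(a + b) * (y0 - c) + (a - b) * (y0 + c) = 0"
    then have "2 * (a * y0 - c * b) = 0" by (simp add: algebra_simps)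
    with y0 nz show False by (simp add: field_simps)
  qed
  have half: "n div 2 + (n + 1) div 2 = n" by presburger
  have p': "p = [:- c, 1:]^(1 + n div 2) * [:y0 + c:]^(n div 2) *
     [:- ((a + b) * (c * (y0 - c)) - (a - b) * (c * (y0 + c))), - ((a + b) * (y0 - c) + (a - b) * (y0 + c)):] ^ ((n + 1) div 2)"
    unfolding p_def orbit_num_def
    by (intro arg_cong2[of _ _ _ _ "(*)"] arg_cong2[of _ _ _ _ "(^)"]) (simp_all add: algebra_simps)
  have q': "q = [:c, 1:]^(1 + n div 2) * [:y0 - c:]^(n div 2) *
     [:(a - b) * (c * (y0 - c)) - (a + b) * (c * (y0 + c)), (a - b) * (y0 - c) + (a + b) * (y0 + c):] ^ ((n + 1) div 2)"
    unfolding q_def orbit_den_def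
    by (intro arg_cong2[of _ _ _ _ "(*)"] arg_cong2[of _ _ _ _ "(^)"]) (simp_all add: algebra_simps)
  have "degree p = (1 + n div 2) + (n + 1) div 2"
    unfolding p' by (subst degree_prod3_eq) (use lead y0 in \<open>auto simp: add_eq_0_iff\<close>)
  then have dp: "degree p = n + 1"
    using half by simp
  have "degree q \<le> (1 + n div 2) + (n + 1) div 2"
    unfolding q' by (rule order_trans[OF degree_prod3_le]) auto
  then have dq: "degree q \<le> n + 1"
    using half by simp
  have "p \<noteq> q"
    using no_root dp by (intro neq_if_no_common_root) auto
  from orbit_x_specialize[OF p_def q_def nz(3) this no_root]
  show "\<exists>g. has_value const1 (orbit_x a b c n) (var1, const1 y0) g \<and> ratfun_degree g = n + 1"
    using dp dq by (simp add: var1_def const1_def max_def)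
qed

lemma degree_in_y_orbit_x: "degree_in_y (orbit_x a b c n) = n"
proof (rule degree_in_y_eqI)
  \<comment> \<open>Now the last factor of \<open>q\<close> has the leading coefficient 2 (a x0 - b
    c), so \<open>q\<close> attains the degree. The surplus factor in x is constant in y, which
    lowers the degree to n.\<close>
  show "finite {c, - c, c * b / a}" by simp
  fix x0 assume x0: "x0 \<notin> {c, - c, c * b / a}"
  define p where "p = orbit_num [:a:] [:b:] [:c:] n [:x0:] [:0, 1:]"
  define q where "q = orbit_den [:a:] [:b:] [:c:] n [:x0:] [:0, 1:]"
  have poly: "poly p z = orbit_num a b c n x0 z" "poly q z = orbit_den a b c n x0 z" for z
    by (simp_all add: p_def q_def comm_ring_hom.hom_orbit_num[OF poly_hom]
        comm_ring_hom.hom_orbit_den[OF poly_hom])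
  have no_root: "\<not> (poly p z = 0 \<and> poly q z = 0)" for z
    unfolding poly using orbit_no_common_zero x0 nz by auto
  have lead: "(a - b) * (x0 + c) + (a + b) * (x0 - c) \<noteq> 0"
  proof
    assume "(a - b) * (x0 + c) + (a + b) * (x0 - c) = 0"
    then have "2 * (a * x0 - c * b) = 0" by (simp add: algebra_simps)
    with x0 nz show False by (simp add: field_simps)
  qed
  have half: "n div 2 + (n + 1) div 2 = n" by presburger
  have p': "p = [:x0 - c:]^(1 + n div 2) * [:c, 1:]^(n div 2) *
     [:(a + b) * (c * (x0 + c)) - (a - b) * (c * (x0 - c)), - ((a + b) * (x0 + c) + (a - b) * (x0 - c)):] ^ ((n + 1) div 2)"
    unfolding p_def orbit_num_def
    by (intro arg_cong2[of _ _ _ _ "(*)"] arg_cong2[of _ _ _ _ "(^)"]) (simp_all add: algebra_simps)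
  have q': "q = [:x0 + c:]^(1 + n div 2) * [:- c, 1:]^(n div 2) *
     [:(a + b) * (c * (x0 - c)) - (a - b) * (c * (x0 + c)), (a - b) * (x0 + c) + (a + b) * (x0 - c):] ^ ((n + 1) div 2)"
    unfolding q_def orbit_den_def
    by (intro arg_cong2[of _ _ _ _ "(*)"] arg_cong2[of _ _ _ _ "(^)"]) (simp_all add: algebra_simps)
  have "degree q = n div 2 + (n + 1) div 2"
    unfolding q' by (subst degree_prod3_eq) (use lead x0 in \<open>auto simp: add_eq_0_iff\<close>)
  then have dq: "degree q = n"
    using half by simp
  have "degree p \<le> n div 2 + (n + 1) div 2"
    unfolding p' by (rule order_trans[OF degree_prod3_le]) auto
  then have dp: "degree p \<le> n"
    using half by simp
  have "p \<noteq> q"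
  proof (cases n)
    case 0
    then show ?thesis
      using nz by (simp add: p' q')
  next
    case (Suc m)
    then show ?thesis
      using no_root dq by (intro neq_if_no_common_root) auto
  qed
  from orbit_x_specialize[OF p_def q_def nz(3) this no_root]
  show "\<exists>g. has_value const1 (orbit_x a b c n) (const1 x0, var1) g \<and> ratfun_degree g = n"
    using dp dq by (simp add: var1_def const1_def max_def)
qed

end

subsection \<open>The map on rational functions\<close>

lemma phi_eq: "phi a b c = (phi_x (const2 a) (const2 b) (const2 c) varx vary, varx)"
  by (simp add: phi_def phi_x_def c2.hom_simps)

lemma rat_comp_eqI:
  assumes "has_value const2 (fst F) G u" "has_value const2 (snd F) G v"
  shows "comp_defined F G \<and> rat_comp F G = (u, v)"
  using assms c2.ratfun_value_eq by (auto simp: comp_defined_def rat_comp_def)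

lemma rat_comp_phi:
  assumes "phi_den (const2 a) (const2 b) (const2 c) g h \<noteq> 0"
  shows "comp_defined (phi a b c) (g, h) \<and>
    rat_comp (phi a b c) (g, h) = (phi_x (const2 a) (const2 b) (const2 c) g h, g)"
  unfolding phi_eq using assms by (intro rat_comp_eqI) (auto intro: c2.has_value_phi_x c2.has_value_varx)

lemma const2_eq_0_iff: "const2 a = 0 \<longleftrightarrow> a = 0"
  by (simp add: const2_def)

lemma ratfun2_two_neq_0: "(2::ratfun2) \<noteq> 0"
proof -
  have "const2 2 = (2::ratfun2)"
    using c2.hom_add[of 1 1] c2.hom_1 by simp
  then show ?thesis
    using const2_eq_0_iff[of 2] by simp
qed

lemma cayley_inverse:
  fixes c x :: "'a::field"
  assumes "(2::'a) \<noteq> 0" "c \<noteq> 0" "x + c \<noteq> 0"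
  shows "cayley c ((x - c) / (x + c)) = x"
proof -
  have "1 + (x - c) / (x + c) = 2 * x / (x + c)" "1 - (x - c) / (x + c) = 2 * c / (x + c)"
    using assms by (simp_all add: field_simps)
  then show ?thesis
    unfolding cayley_def using assms by simp
qed

context
  fixes a b c :: complex
  assumes nz: "a \<noteq> 0" "b \<noteq> 0" "c \<noteq> 0" "a \<noteq> b"
begin

private abbreviation "N n \<equiv> orbit_num (const2 a) (const2 b) (const2 c) n varx vary"
private abbreviation "D n \<equiv> orbit_den (const2 a) (const2 b) (const2 c) n varx vary"

lemma linear_factors_nz:
  "varx + const2 c \<noteq> 0" "varx - const2 c \<noteq> 0" "vary + const2 c \<noteq> 0" "vary - const2 c \<noteq> 0"
  by (rule pt.nonzero_if_has_value[of _ "(0, 0)"], (rule pt.has_value_intros)+, use nz in simp)+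

text \<open>Both forms take the value - 2 a c^2 at the origin.\<close>

lemma quadratic_factors_nz:
  "(const2 a - const2 b) * ((varx + const2 c) * (vary - const2 c))
     + (const2 a + const2 b) * ((varx - const2 c) * (vary + const2 c)) \<noteq> 0"
  "(const2 a + const2 b) * ((varx + const2 c) * (vary - const2 c))
     + (const2 a - const2 b) * ((varx - const2 c) * (vary + const2 c)) \<noteq> 0"
  by (rule pt.nonzero_if_has_value[of _ "(0, 0)"], (rule pt.has_value_intros)+, use nz in \<open>simp add: algebra_simps\<close>)+

lemma orbit_num_nz: "N n \<noteq> 0" and orbit_den_nz: "D n \<noteq> 0"
  using linear_factors_nz quadratic_factors_nz
  by (simp_all only: orbit_num_def orbit_den_def mult_eq_0_iff[of _ "_ ^ _"] power_eq_0_iff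
      neg_equal_0_iff_equal simp_thms)

text \<open>At (c, 0) the numerator vanishes through its factor x - c, while the denominator does
  not because \<open>a \<noteq> b\<close>.\<close>

lemma orbit_den_minus_num_nz: "D n - N n \<noteq> 0"
  by (rule pt.nonzero_if_has_value[of _ "(c, 0)"], rule pt.has_value_diff,
      rule pt.has_value_orbit_den, rule pt.has_value_orbit_num)
    (use nz in \<open>simp add: orbit_num_def orbit_den_def\<close>)

lemma orbit_x_eq_cayley: "orbit_x a b c n = cayley (const2 c) (N n / D n)"
proof -
  have "1 + N n / D n = (D n + N n) / D n" "1 - N n / D n = (D n - N n) / D n"
    using orbit_den_nz by (simp_all add: add_divide_distrib diff_divide_distrib)
  then show ?thesis
    using orbit_den_nz by (simp add: cayley_def orbit_x_def Let_def)
qed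

lemma phi_den_nz: "phi_den (const2 a) (const2 b) (const2 c) varx vary \<noteq> 0"
  unfolding phi_den_def
  \<comment> \<open>The value at (c, 0) is c^3 (a - b).\<close>
  by (rule pt.nonzero_if_has_value[of _ "(c, 0)"], (rule pt.has_value_intros)+, use nz in simp)

text \<open>By induction the iterate has Cayley coordinates \<open>w n\<close> and
  \<open>w n / s n\<close>. The index starts at 1, where \<open>w (Suc n) / s (Suc n) = w n\<close>
  turns the second coordinate into the preceding first one.\<close>

lemma rat_iterate_phi: "rat_iterate (phi a b c) (Suc n) =
    (orbit_x a b c (Suc n), orbit_x a b c n)"
proof -
  define r where "r = (varx - const2 c) * (vary + const2 c) / ((varx + const2 c) * (vary - const2 c))"
  define w where "w n = N n / D n" for n
  define s where "s n = (if even n then r else ratio_step (const2 a) (const2 b) r)" for n :: nat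
  have K: "const2 a \<noteq> 0" "const2 b \<noteq> 0" "const2 c \<noteq> 0"
    using nz by (simp_all add: const2_eq_0_iff)
  have r: "(const2 a - const2 b) + (const2 a + const2 b) * r \<noteq> 0"
    and wSuc: "w (Suc n) = w n * ratio_step (const2 a) (const2 b) (s n)" for n
    using orbit_ratio_Suc[OF ratfun2_two_neq_0 K(1,2) linear_factors_nz(1,3,4) quadratic_factors_nz(1)]
    unfolding r_def w_def s_def by blast+
  have r0: "r \<noteq> 0"
    using linear_factors_nz by (simp add: r_def)
  have w0: "w n \<noteq> 0" for n
    using orbit_num_nz orbit_den_nz by (simp add: w_def)
  have w1: "w n \<noteq> 1" for n
    using orbit_den_minus_num_nz[of n] by (auto simp: w_def)
  have sSuc: "s (Suc n) = ratio_step (const2 a) (const2 b) (s n)" for n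
    using ratio_step_involution[OF ratfun2_two_neq_0 K(1,2) r] by (simp add: s_def)
  \<comment> \<open>For odd n the value is m(r), which is nonzero because
    \<open>w 1 = w 0 * m(r)\<close> is.\<close>
  have s0: "s n \<noteq> 0" for n
    using r0 w0[of 1] wSuc[of 0] by (auto simp: s_def)
  have s1: "(const2 a - const2 b) + (const2 a + const2 b) * s n \<noteq> 0" for n
    using r ratio_step_nonzero[OF ratfun2_two_neq_0 K(1,2) r] by (simp add: s_def)
  have ws: "w (Suc n) / s (Suc n) = w n" for n
    using s0[of "Suc n"] unfolding wSuc sSuc by simp
  have v: "w 0 / s 0 = (vary - const2 c) / (vary + const2 c)"
    using linear_factors_nz by (simp add: w_def s_def r_def orbit_num_def orbit_den_def)
  \<comment> \<open>This keeps the second coordinate finite: at n = 0 it is y itself, and afterwards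
    it is the previous first coordinate.\<close>
  have "w n / s n \<noteq> 1" for n
  proof (cases n)
    case 0
    have "vary - const2 c \<noteq> vary + const2 c"
      using ratfun2_two_neq_0 K by (simp add: diff_eq_eq add.assoc flip: mult_2)
    then show ?thesis
      using 0 v linear_factors_nz by simp
  next
    case (Suc m)
    then show ?thesis using ws w1 by simp
  qed
  note step = cayley_phi[OF ratfun2_two_neq_0 K(3) w0 s0 w1 this s1 w1[of "Suc n" for n, unfolded wSuc]]
  have "rat_iterate (phi a b c) n = (cayley (const2 c) (w n), cayley (const2 c) (w n / s n))" for n
  proof (induction n)
    case 0
    have "w 0 = (varx - const2 c) / (varx + const2 c)"
      by (simp add: w_def orbit_num_def orbit_den_def)
    then show ?case
      unfolding v using cayley_inverse[OF ratfun2_two_neq_0 K(3)] linear_factors_nz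
      by (simp add: rat_iterate_def id_map_def)
  next
    case (Suc n)
    have "rat_iterate (phi a b c) (Suc n) = rat_comp (phi a b c) (rat_iterate (phi a b c) n)"
      by (simp add: rat_iterate_def)
    also have "\<dots> = (cayley (const2 c) (w (Suc n)), cayley (const2 c) (w n))"
      unfolding Suc.IH wSuc using rat_comp_phi[OF step(1)[of n]] step(2)[of n] by simp
    finally show ?case
      unfolding ws .
  qed
  from this[of "Suc n"] show ?thesis
    unfolding ws by (simp add: orbit_x_eq_cayley w_def)
qed

lemma birational_phi: "birational (phi a b c)"
proof -
  define P where "P = phi_x (const2 a) (const2 b) (const2 c)"
  \<comment> \<open>The old x is the new second coordinate, and the old y is recovered from the new
    pair by the involution in the second argument.\<close>
  define G where "G = (vary, P vary varx)"
  have K: "const2 a \<noteq> 0" "const2 b \<noteq> 0" "const2 c \<noteq> 0"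
    using nz by (simp_all add: const2_eq_0_iff)
  have den': "phi_den (const2 a) (const2 b) (const2 c) vary varx \<noteq> 0"
    unfolding phi_den_def
    by (rule pt.nonzero_if_has_value[of _ "(0, c)"], (rule pt.has_value_intros)+, use nz in simp)
  have sq: "varx^2 \<noteq> (const2 c)^2" "vary^2 \<noteq> (const2 c)^2"
    using linear_factors_nz by (auto simp: power2_eq_iff eq_neg_iff_add_eq_0)
  note inv = phi_x_involution[OF K sq(1) phi_den_nz, folded P_def]
    and inv' = phi_x_involution[OF K sq(2) den', folded P_def]
  have "comp_defined (phi a b c) G \<and> rat_comp (phi a b c) G = (varx, vary)"
    using rat_comp_phi[OF inv'(1)] inv'(2) by (simp add: G_def P_def)
  moreover have "has_value const2 (P vary varx) (phi a b c) (P varx (P varx vary))"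
    unfolding P_def phi_eq phi_x_def[of _ _ _ vary varx] phi_x_def[of _ _ _ varx "phi_x _ _ _ _ _"]
    by (intro c2.has_value_intros) (use inv(1) in \<open>simp add: P_def phi_den_def\<close>)
  then have "comp_defined G (phi a b c) \<and> rat_comp G (phi a b c) = (varx, vary)"
    using rat_comp_eqI[of G "phi a b c" varx "P varx (P varx vary)"] c2.has_value_vary inv(2)
    by (simp add: G_def phi_eq)
  ultimately show ?thesis
    unfolding birational_def id_map_def by blast
qed

end

section \<open>The change of variables (s, t) and the transformed map\<close>

lemma birational_st_map:
  assumes "c \<noteq> 0"
  shows "birational (st_map c)"
proof -
  define C X Y where "C = const2 c" and "X = varx" and "Y = vary"
  note defs = C_def X_def Y_def
  \<comment> \<open>For fixed x the map from y to s is an involution, so the inverse is x = t, y =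
    c^2 (t - s)/(c^2 - s t). In \<open>y\<close> the variables X and Y stand for s and t.\<close>
  define y s where "y = C^2 * (Y - X) / (C^2 - X * Y)" and "s = C^2 * (X - Y) / (C^2 - X * Y)"
  have st: "st_map c = (s, X)"
    by (simp add: st_map_def s_def defs c2.hom_simps)
  have C: "C \<noteq> 0" and XY: "C^2 - X * Y \<noteq> 0" and XX: "C^2 - X * X \<noteq> 0" and YY: "C^2 - Y * Y \<noteq> 0"
    unfolding defs
    by (rule pt.nonzero_if_has_value[of _ "(0, 0)"], (rule pt.has_value_intros)+, use assms in simp)+
  have y: "y * (C^2 - X * Y) = C^2 * (Y - X)" and s: "s * (C^2 - X * Y) = C^2 * (X - Y)"
    using XY by (simp_all add: y_def s_def)
  have 1: "(C^2 - Y * y) * (C^2 - X * Y) = C^2 * (C^2 - Y * Y)"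
    and 2: "(Y - y) * (C^2 - X * Y) = X * (C^2 - Y * Y)"
    and 3: "(C^2 - s * X) * (C^2 - X * Y) = C^2 * (C^2 - X * X)"
    and 4: "(X - s) * (C^2 - X * Y) = Y * (C^2 - X * X)"
    using y s by algebra+
  have nz: "C^2 - Y * y \<noteq> 0" "C^2 - s * X \<noteq> 0"
    using 1 3 C XX YY by (metis mult_eq_0_iff power_not_zero)+
  have "C^2 * (Y - y) * (C^2 - X * Y) = X * (C^2 - Y * y) * (C^2 - X * Y)"
    "C^2 * (X - s) * (C^2 - X * Y) = Y * (C^2 - s * X) * (C^2 - X * Y)"
    using 1 2 3 4 by algebra+
  then have eq: "C^2 * (Y - y) / (C^2 - Y * y) = X" "C^2 * (X - s) / (C^2 - s * X) = Y"
    using XY nz by simp_all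
  have "has_value const2 s (Y, y) (C^2 * (Y - y) / (C^2 - Y * y))"
    using nz(1) unfolding s_def defs by (intro c2.has_value_intros)
  then have "comp_defined (st_map c) (Y, y) \<and> rat_comp (st_map c) (Y, y) = (X, Y)"
    using rat_comp_eqI[of "st_map c" "(Y, y)" X Y] c2.has_value_varx eq by (simp add: st X_def)
  moreover have "has_value const2 y (s, X) (C^2 * (X - s) / (C^2 - s * X))"
    using nz(2) unfolding y_def defs by (intro c2.has_value_intros)
  then have "comp_defined (Y, y) (st_map c) \<and> rat_comp (Y, y) (st_map c) = (X, Y)"
    using rat_comp_eqI[of "(Y, y)" "st_map c" X Y] c2.has_value_vary eq by (simp add: st Y_def)
  ultimately show ?thesis
    unfolding birational_def id_map_def defs by blast
qed

text \<open>The four degrees are n + 1 and n for x_n, and n and n - 1 for y_n = x_(n-1).\<close>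

lemma map_degree_rat_iterate_phi:
  assumes "a \<noteq> 0" "b \<noteq> 0" "c \<noteq> 0" "a \<noteq> b" "n \<ge> 1"
  shows "map_degree (rat_iterate (phi a b c) n) = n + 1"
proof -
  obtain m where "n = Suc m"
    using assms(5) by (cases n) auto
  then show ?thesis
    by (simp add: map_degree_def rat_iterate_phi[OF assms(1-4)]
        degree_in_x_orbit_x[OF assms(1-4)] degree_in_y_orbit_x[OF assms(1-4)])
qed

lemma st_map_phi:
  assumes nz: "a \<noteq> 0" "b \<noteq> 0" "c \<noteq> 0" "a \<noteq> b"
  defines "s \<equiv> fst (st_map c)" and "t \<equiv> snd (st_map c)"
  shows "rat_comp (st_map c) (phi a b c) =
    (- const2 (a * c^2) / (const2 b * s), (const2 (a * c^2) - const2 b * s * t) / (const2 a * t - const2 b * s))"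
proof -
  define A B C X Y where "A = const2 a" and "B = const2 b" and "C = const2 c" and "X = varx" and "Y = vary"
  note defs = A_def B_def C_def X_def Y_def
  define z where "z = phi_x A B C X Y"
  define d where "d = phi_den A B C X Y"
  have K: "A \<noteq> 0" "B \<noteq> 0" "C \<noteq> 0"
    using nz by (simp_all add: const2_eq_0_iff defs)
  have d: "d \<noteq> 0"
    unfolding d_def defs by (rule phi_den_nz[OF nz])
  have XY: "C^2 - X * Y \<noteq> 0" and XX: "C^2 - X^2 \<noteq> 0"
    unfolding defs
    by (rule pt.nonzero_if_has_value[of _ "(0, 0)"], (rule pt.has_value_intros)+, use nz in simp)+
  have xy: "X - Y \<noteq> 0"
    unfolding defs
    by (rule pt.nonzero_if_has_value[of _ "(c, 0)"], (rule pt.has_value_intros)+, use nz in simp)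
  have s: "s = C^2 * (X - Y) / (C^2 - X * Y)" and t: "t = X"
    by (simp_all add: s_def t_def st_map_def defs c2.hom_simps)
  have s': "s * (C^2 - X * Y) = C^2 * (X - Y)"
    using XY by (simp add: s)
  have z: "z * d = C^2 * ((B - A) * X * Y + A * C^2 - B * X^2)"
    using d by (simp add: z_def d_def phi_x_def phi_den_def)
  \<comment> \<open>This factorisation and the next one share \<open>C^2 - X^2\<close>; in their
    quotient it cancels, leaving a multiple of 1/s.\<close>
  have zX: "(z - X) * d = A * (C^2 - X * Y) * (C^2 - X^2)"
  proof -
    have "(z - X) * d = z * d - X * d" by algebra
    also have "\<dots> = A * (C^2 - X * Y) * (C^2 - X^2)"
      unfolding z unfolding d_def phi_den_def by algebra
    finally show ?thesis .
  qed
  have CzX: "(C^2 - z * X) * d = - (C^2 * B * (X - Y) * (C^2 - X^2))"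
  proof -
    have "(C^2 - z * X) * d = C^2 * d - X * (z * d)" by algebra
    also have "\<dots> = - (C^2 * B * (X - Y) * (C^2 - X^2))"
      unfolding z unfolding d_def phi_den_def by algebra
    finally show ?thesis .
  qed
  have nzv: "C^2 - z * X \<noteq> 0"
    using CzX K XX xy by auto
  have "has_value const2 (fst (st_map c)) (z, X) (C^2 * (z - X) / (C^2 - z * X))"
    unfolding st_map_def fst_conv C_def c2.hom_power
    by (intro c2.has_value_intros) (use nzv in \<open>simp add: C_def\<close>)
  moreover have "has_value const2 (snd (st_map c)) (z, X) z"
    by (simp add: st_map_def c2.has_value_varx)
  ultimately have "rat_comp (st_map c) (phi a b c) = (C^2 * (z - X) / (C^2 - z * X), z)"
    using rat_comp_eqI[of "st_map c" "(z, X)"] by (simp add: phi_eq z_def defs)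
  moreover have "C^2 * (z - X) / (C^2 - z * X) = - (A * C^2) / (B * s)"
  proof -
    have "C^2 * (z - X) / (C^2 - z * X) = C^2 * ((z - X) * d) / ((C^2 - z * X) * d)"
      using d by simp
    also have "\<dots> = - (A * C^2) / (B * s)"
      unfolding zX CzX s using K XX XY xy by simp
    finally show ?thesis .
  qed
  moreover have "z = (A * C^2 - B * s * X) / (A * X - B * s)"
  proof -
    have "(A * X - B * s) * (C^2 - X * Y) = A * X * (C^2 - X * Y) - B * (s * (C^2 - X * Y))"
      by algebra
    also have "\<dots> = d"
      unfolding s' d_def phi_den_def by algebra
    finally have 1: "(A * X - B * s) * (C^2 - X * Y) = d" .
    have "(A * C^2 - B * s * X) * (C^2 - X * Y) = A * C^2 * (C^2 - X * Y) - B * X * (s * (C^2 - X * Y))"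
      by algebra
    also have "\<dots> = z * d"
      unfolding s' z by algebra
    finally have 2: "(A * C^2 - B * s * X) * (C^2 - X * Y) = z * d" .
    \<comment> \<open>Both \<open>z * d\<close> and \<open>d\<close> are rewritten as products with
      the common factor \<open>C^2 - X * Y\<close>, which then cancels.\<close>
    have "(A * C^2 - B * s * X) / (A * X - B * s) = z * d / d"
      unfolding 1[symmetric] 2[symmetric, unfolded 1[symmetric]] using XY by simp
    then show ?thesis using d by simp
  qed
  ultimately show ?thesis
    by (simp add: t c2.hom_simps flip: defs)
qed

theorem mainTheorem3:
  fixes \<alpha> \<beta> c :: complex
  assumes "\<alpha> \<noteq> 0" and "\<beta> \<noteq> 0" and "c \<noteq> 0" and "\<alpha> \<noteq> \<beta>"
  shows "birational (phi \<alpha> \<beta> c)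
    \<and> (\<forall>n\<ge>1. map_degree (rat_iterate (phi \<alpha> \<beta> c) n) = n + 1)
    \<and> birational (st_map c)
    \<and> (let s = fst (st_map c); t = snd (st_map c);
           sbar = fst (rat_comp (st_map c) (phi \<alpha> \<beta> c));
           tbar = snd (rat_comp (st_map c) (phi \<alpha> \<beta> c))
       in sbar = - const2 (\<alpha> * c^2) / (const2 \<beta> * s)
        \<and> tbar = (const2 (\<alpha> * c^2) - const2 \<beta> * s * t) / (const2 \<alpha> * t - const2 \<beta> * s))"
  using birational_phi[OF assms] map_degree_rat_iterate_phi[OF assms] birational_st_map[OF assms(3)]
    st_map_phi[OF assms]
  by (simp add: Let_def)

end
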